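(* If a graph $G$ has linear arboricity $2$, then $G$ is a unit rectangle visibility graph.
   Context: Graphs are finite and simple. The linear arboricity of a graph $G$ is the minimum number of linear forests (forests in which every component is a path) whose union is $G$. A graph $G$ is a unit rectangle visibility graph (URVG) if its vertices $v$ can be represented by closed unit squares $S_v$ in the plane with sides parallel to the coordinate axes and with pairwise disjoint interiors (squares may touch along their boundaries), in such a way that two distinct vertices $v,w$ are adjacent if and only if there is an unobstructed non-degenerate (positive width) horizontal or vertical band of visibility joining $S_v$ and $S_w$. Here a horizontal band of visibility joining $S_v$ and $S_w$ is given by an open interval $I$ of positive length such that for every $y_0\in I$ the line $y=y_0$ meets the interiors of both $S_v$ and $S_w$, and the part of this line between $S_v$ and $S_w$ (possibly a single point if the squares touch) meets the interior of no other square of the representation; vertical bands are defined analogously with the roles of $x$ and $y$ exchanged. *)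

theory Defs
  imports "HOL-Analysis.Analysis"
begin

section \<open>Finite simple graphs and linear arboricity\<close>

record 'a ugraph =
  verts :: "'a set"
  edges :: "'a set set"

definition simple_graph :: "'a ugraph \<Rightarrow> bool" where
  "simple_graph G \<longleftrightarrow>
     finite (verts G) \<and> (\<forall>e\<in>edges G. e \<subseteq> verts G \<and> card e = 2)"

definition connected_in :: "'a ugraph \<Rightarrow> 'a \<Rightarrow> 'a \<Rightarrow> bool" where
  "connected_in G v w \<longleftrightarrow> (v, w) \<in> {(a, b). {a, b} \<in> edges G}\<^sup>*"

definition component_of :: "'a ugraph \<Rightarrow> 'a \<Rightarrow> 'a ugraph" where
  "component_of G v =
     (let C = {w \<in> verts G. connected_in G v w}
      in \<lparr>verts = C, edges = {e \<in> edges G. e \<subseteq> C}\<rparr>)"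

text \<open>A path may consist of a single vertex.\<close>

definition path_graph :: "'a ugraph \<Rightarrow> bool" where
  "path_graph G \<longleftrightarrow>
     (\<exists>xs. xs \<noteq> [] \<and> distinct xs \<and> verts G = set xs \<and>
           edges G = {{xs ! i, xs ! Suc i} | i. Suc i < length xs})"

definition cycle_in :: "'a ugraph \<Rightarrow> 'a list \<Rightarrow> bool" where
  "cycle_in G xs \<longleftrightarrow>
     3 \<le> length xs \<and> distinct xs \<and> set xs \<subseteq> verts G \<and>
     (\<forall>i. Suc i < length xs \<longrightarrow> {xs ! i, xs ! Suc i} \<in> edges G) \<and>
     {last xs, hd xs} \<in> edges G"

definition forest :: "'a ugraph \<Rightarrow> bool" where
  "forest G \<longleftrightarrow> simple_graph G \<and> (\<nexists>xs. cycle_in G xs)"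

definition linear_forest :: "'a ugraph \<Rightarrow> bool" where
  "linear_forest G \<longleftrightarrow> forest G \<and> (\<forall>v\<in>verts G. path_graph (component_of G v))"

definition union_of_linear_forests :: "'a ugraph \<Rightarrow> nat \<Rightarrow> bool" where
  "union_of_linear_forests G k \<longleftrightarrow>
     (\<exists>F. (\<forall>i<k. linear_forest (F i)) \<and>
          verts G = (\<Union>i<k. verts (F i)) \<and>
          edges G = (\<Union>i<k. edges (F i)))"

definition linear_arboricity :: "'a ugraph \<Rightarrow> nat" where
  "linear_arboricity G = (LEAST k. union_of_linear_forests G k)"

text \<open>
  For finite simple graphs the minimum is attained: every set of at most one edge, together
  with all the vertices, is a linear forest.
\<close>

lemma linear_forest_at_most_one_edge:
  assumes G: "simple_graph G" and E: "edges G \<subseteq> {{a, b}}"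
  shows "linear_forest G"
proof -
  have "\<not> cycle_in G xs" for xs
  proof
    assume c: "cycle_in G xs"
    then have len: "3 \<le> length xs" and d: "distinct xs"
      and e: "\<And>i. Suc i < length xs \<Longrightarrow> {xs ! i, xs ! Suc i} \<in> edges G"
      by (auto simp: cycle_in_def)
    have "{xs ! 0, xs ! 1} = {a, b}" "{xs ! 1, xs ! 2} = {a, b}"
      using e[of 0] e[of 1] len E by (auto simp: numeral_2_eq_2)
    moreover have "xs ! 0 \<noteq> xs ! 2" "xs ! 0 \<noteq> xs ! 1"
      using len nth_eq_iff_index_eq[OF d, of 0 2] nth_eq_iff_index_eq[OF d, of 0 1] by linarith+
    ultimately show False by (metis doubleton_eq_iff)
  qed
  then have forest: "forest G" using G by (auto simp: forest_def)
  have "path_graph (component_of G v)" if v: "v \<in> verts G" for v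
  proof (cases "edges G \<noteq> {} \<and> v \<in> {a, b}")
    case True
    then have EG: "edges G = {{a, b}}" using E by auto
    with G have ab: "a \<noteq> b" "a \<in> verts G" "b \<in> verts G"
      by (auto simp: simple_graph_def)
    have step: "(a, b) \<in> {(x, y). {x, y} \<in> edges G}" "(b, a) \<in> {(x, y). {x, y} \<in> edges G}"
      using EG by (auto simp: insert_commute)
    have "w \<in> {a, b}" if "(v, w) \<in> {(x, y). {x, y} \<in> edges G}\<^sup>*" for w
      using that by induction (use True EG in \<open>auto simp: doubleton_eq_iff\<close>)
    then have "{w \<in> verts G. connected_in G v w} = {a, b}"
      using True ab step by (auto simp: connected_in_def)
    then have "component_of G v = \<lparr>verts = {a, b}, edges = {{a, b}}\<rparr>"
      using EG by (auto simp: component_of_def Let_def)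
    then show ?thesis
      using ab by (auto simp: path_graph_def intro!: exI[of _ "[a, b]"])
  next
    case False
    have "w = v" if "(v, w) \<in> {(x, y). {x, y} \<in> edges G}\<^sup>*" for w
      using that by induction (use False E in \<open>auto simp: doubleton_eq_iff\<close>)
    then have C: "{w \<in> verts G. connected_in G v w} = {v}"
      using v by (auto simp: connected_in_def)
    have "{e \<in> edges G. e \<subseteq> {v}} = {}"
      using G by (auto simp: simple_graph_def card_2_iff)
    with C have "component_of G v = \<lparr>verts = {v}, edges = {}\<rparr>"
      by (simp add: component_of_def Let_def)
    then show ?thesis
      by (auto simp: path_graph_def intro!: exI[of _ "[v]"])
  qed
  with forest show ?thesis by (simp add: linear_forest_def)
qed

lemma ex_union_of_linear_forests:
  assumes "simple_graph G"
  shows "\<exists>k. union_of_linear_forests G k"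
proof -
  have "edges G \<subseteq> Pow (verts G)" "finite (verts G)"
    using assms by (auto simp: simple_graph_def)
  then have "finite (edges G)" by (meson finite_Pow_iff finite_subset)
  then obtain es where es: "set es = edges G" using finite_list by blast
  define F where "F i = \<lparr>verts = verts G, edges = (if i < length es then {es ! i} else {})\<rparr>" for i
  have sub: "simple_graph (F i)" for i
    using assms nth_mem[of i es] by (auto simp: simple_graph_def F_def es)
  have "\<exists>a b. edges (F i) \<subseteq> {{a, b}}" for i
  proof (cases "i < length es")
    case True
    then have "card (es ! i) = 2"
      using assms nth_mem[of i es] by (auto simp: simple_graph_def es)
    then show ?thesis using True by (auto simp: F_def card_2_iff)
  qed (simp add: F_def)
  then have "linear_forest (F i)" for i
    using sub linear_forest_at_most_one_edge by metis
  moreover have "verts G = (\<Union>i<Suc (length es). verts (F i))"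
    by (auto simp: F_def)
  moreover have "edges G = (\<Union>i<Suc (length es). edges (F i))"
  proof (intro set_eqI iffI)
    fix e assume "e \<in> edges G"
    then obtain i where "i < length es" "es ! i = e" by (auto simp: es[symmetric] in_set_conv_nth)
    then show "e \<in> (\<Union>i<Suc (length es). edges (F i))" by (auto simp: F_def intro!: bexI[of _ i])
  next
    fix e assume "e \<in> (\<Union>i<Suc (length es). edges (F i))"
    then show "e \<in> edges G" by (auto simp: F_def simp flip: es split: if_splits)
  qed
  ultimately show ?thesis by (auto simp: union_of_linear_forests_def)
qed


section \<open>Unit rectangle visibility graphs\<close>

definition unit_square :: "real \<times> real \<Rightarrow> (real \<times> real) set" where
  "unit_square p = cbox p (p + (1, 1))"

definition horizontal_line :: "real \<Rightarrow> (real \<times> real) set" where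
  "horizontal_line c = {(x, y). y = c}"

text \<open>
  The part of the line \<open>y = c\<close> from \<open>S\<close> (on the left) to \<open>T\<close> (on the right), end points included.
  It is a single point if the two squares touch there, and it is empty if the line meets the
  interior of both squares and \<open>S\<close> lies to the right of \<open>T\<close>.
\<close>

definition part_from_to ::
    "real \<Rightarrow> (real \<times> real) set \<Rightarrow> (real \<times> real) set \<Rightarrow> (real \<times> real) set" where
  "part_from_to c S T =
     {(x, y). y = c \<and> (\<forall>s. (s, c) \<in> S \<longrightarrow> s \<le> x) \<and> (\<forall>t. (t, c) \<in> T \<longrightarrow> x \<le> t)}"

definition part_between ::
    "real \<Rightarrow> (real \<times> real) set \<Rightarrow> (real \<times> real) set \<Rightarrow> (real \<times> real) set" where
  "part_between c S T = part_from_to c S T \<union> part_from_to c T S"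

text \<open>Vertex \<open>v\<close> is represented by the unit square with lower left corner \<open>p v\<close>.\<close>

definition horizontal_band :: "'a set \<Rightarrow> ('a \<Rightarrow> real \<times> real) \<Rightarrow> 'a \<Rightarrow> 'a \<Rightarrow> bool" where
  "horizontal_band V p v w \<longleftrightarrow>
     (\<exists>a b. a < b \<and>
        (\<forall>c\<in>{a<..<b}.
           horizontal_line c \<inter> interior (unit_square (p v)) \<noteq> {} \<and>
           horizontal_line c \<inter> interior (unit_square (p w)) \<noteq> {} \<and>
           (\<forall>u\<in>V - {v, w}.
              part_between c (unit_square (p v)) (unit_square (p w))
                \<inter> interior (unit_square (p u)) = {})))"

text \<open>Vertical bands are horizontal bands after exchanging the two coordinates.\<close>

definition vertical_band :: "'a set \<Rightarrow> ('a \<Rightarrow> real \<times> real) \<Rightarrow> 'a \<Rightarrow> 'a \<Rightarrow> bool" where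
  "vertical_band V p v w \<longleftrightarrow> horizontal_band V (prod.swap \<circ> p) v w"

definition unit_square_representation :: "'a ugraph \<Rightarrow> ('a \<Rightarrow> real \<times> real) \<Rightarrow> bool" where
  "unit_square_representation G p \<longleftrightarrow>
     (\<forall>v\<in>verts G. \<forall>w\<in>verts G. v \<noteq> w \<longrightarrow>
        interior (unit_square (p v)) \<inter> interior (unit_square (p w)) = {}) \<and>
     (\<forall>v\<in>verts G. \<forall>w\<in>verts G. v \<noteq> w \<longrightarrow>
        ({v, w} \<in> edges G \<longleftrightarrow>
           horizontal_band (verts G) p v w \<or> vertical_band (verts G) p v w))"

definition unit_rectangle_visibility_graph :: "'a ugraph \<Rightarrow> bool" where
  "unit_rectangle_visibility_graph G \<longleftrightarrow> (\<exists>p. unit_square_representation G p)"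

end

theory Submission
  imports Defs
begin

text \<open>
  The two linear forests are made edge-disjoint, and the vertices are placed on the \<open>y\<close>-axis
  according to the first forest and on the \<open>x\<close>-axis according to the second one: list the vertices
  path by path and move on by \<open>1/2\<close> between consecutive vertices joined by an edge and by \<open>1\<close>
  otherwise. Then two distinct unit intervals overlap exactly if the vertices are adjacent in the
  respective forest. Overlap in both coordinates is excluded by edge-disjointness, and nothing ever
  blocks a band, since three intervals with a common interior point would form a triangle in a forest.
\<close>

section \<open>Listing the vertices of a linear forest path by path\<close>

definition consecutive :: "'a list \<Rightarrow> 'a set set" where
  "consecutive xs = {{xs ! i, xs ! Suc i} | i. Suc i < length xs}"

text \<open>In general only an inclusion: if both lists are nonempty, the junction contributes the
  pair of the last entry of \<open>xs\<close> and the first entry of \<open>ys\<close>, which need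
  not be an edge.\<close>

lemma consecutive_append: "consecutive xs \<union> consecutive ys \<subseteq> consecutive (xs @ ys)"
proof
  fix e assume "e \<in> consecutive xs \<union> consecutive ys"
  then consider i where "Suc i < length xs" "e = {xs ! i, xs ! Suc i}"
    | i where "Suc i < length ys" "e = {ys ! i, ys ! Suc i}"
    by (auto simp: consecutive_def)
  then show "e \<in> consecutive (xs @ ys)"
  proof cases
    case 1
    then show ?thesis
      by (auto simp: consecutive_def nth_append intro!: exI[of _ i])
  next
    case 2
    then show ?thesis
      by (auto simp: consecutive_def nth_append intro!: exI[of _ "length xs + i"])
  qed
qed

lemma connected_in_sym:
  assumes "connected_in G v w"
  shows "connected_in G w v"
proof -
  have "sym {(a, b). {a, b} \<in> edges G}" by (auto simp: sym_def insert_commute)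
  then have "sym ({(a, b). {a, b} \<in> edges G}\<^sup>*)" by (rule sym_rtrancl)
  with assms show ?thesis by (auto simp: connected_in_def dest: symD)
qed

text \<open>A component is closed under adjacency, so an edge that merely meets it lies inside it
  and is therefore an edge of the path.\<close>

lemma linear_forest_component_list:
  assumes G: "linear_forest G" and v: "v \<in> verts G"
  obtains xs where "distinct xs" "set xs = {w \<in> verts G. connected_in G v w}"
    "\<And>e. e \<in> edges G \<Longrightarrow> e \<inter> set xs \<noteq> {} \<Longrightarrow> e \<in> consecutive xs"
proof -
  let ?C = "{w \<in> verts G. connected_in G v w}"
  have "path_graph (component_of G v)" using assms by (simp add: linear_forest_def)
  then obtain xs where xs: "distinct xs" "set xs = ?C"
    "{e \<in> edges G. e \<subseteq> ?C} = consecutive xs"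
    by (auto simp: path_graph_def component_of_def Let_def consecutive_def)
  have "e \<in> consecutive xs" if e: "e \<in> edges G" "e \<inter> set xs \<noteq> {}" for e
  proof -
    have "e \<subseteq> verts G" "card e = 2"
      using G e(1) by (auto simp: linear_forest_def forest_def simple_graph_def)
    then obtain a b where ab: "e = {a, b}" "a \<in> ?C" "b \<in> verts G"
      using e(2) xs(2) by (auto simp: card_2_iff insert_commute)
    then have "connected_in G v b"
      using e(1) by (auto simp: connected_in_def intro: rtrancl_into_rtrancl)
    then have "e \<subseteq> ?C" using ab by auto
    with e(1) xs(3) show ?thesis by blast
  qed
  then show ?thesis by (rule that[OF xs(1,2)])
qed

text \<open>Induction on \<open>A\<close>, appending the whole component of each vertex not yet
  listed. The closure condition on edges says that \<open>set xs\<close> is a union of components;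
  it carries the induction.\<close>

lemma linear_forest_list_of_subset:
  assumes G: "linear_forest G" and "finite A" and "A \<subseteq> verts G"
  shows "\<exists>xs. distinct xs \<and> A \<subseteq> set xs \<and> set xs \<subseteq> verts G \<and>
    (\<forall>e\<in>edges G. e \<inter> set xs \<noteq> {} \<longrightarrow> e \<subseteq> set xs \<and> e \<in> consecutive xs)"
  using assms(2,3)
proof (induction A rule: finite_induct)
  case empty
  show ?case by (auto intro!: exI[of _ "[]"])
next
  case (insert v A)
  then obtain xs where xs: "distinct xs" "A \<subseteq> set xs" "set xs \<subseteq> verts G"
    "\<And>e. e \<in> edges G \<Longrightarrow> e \<inter> set xs \<noteq> {} \<Longrightarrow> e \<subseteq> set xs \<and> e \<in> consecutive xs"
    by auto
  show ?case
  proof (cases "v \<in> set xs")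
    case True
    then show ?thesis using xs by (auto intro!: exI[of _ xs])
  next
    case False
    obtain ys where ys: "distinct ys" "set ys = {w \<in> verts G. connected_in G v w}"
      "\<And>e. e \<in> edges G \<Longrightarrow> e \<inter> set ys \<noteq> {} \<Longrightarrow> e \<in> consecutive ys"
      using linear_forest_component_list[OF G] insert.prems by blast
    \<comment> \<open>If the component of \<open>v\<close> met \<open>set xs\<close>, this closure
      together with symmetry of connectedness would put \<open>v\<close> into
      \<open>set xs\<close>.\<close>
    have closed: "b \<in> set xs" if "connected_in G a b" "a \<in> set xs" for a b
      using that(1) unfolding connected_in_def
    proof induction
      case base
      show ?case by (rule that(2))
    next
      case (step y z)
      then show ?case using xs(4)[of "{y, z}"] by auto
    qed
    have "set xs \<inter> set ys = {}"
      using closed connected_in_sym False unfolding ys(2) by fast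
    moreover have "v \<in> set ys"
      using insert.prems by (auto simp: ys(2) connected_in_def)
    moreover have sub: "e \<subseteq> set ys" if "e \<in> consecutive ys" for e
      using that by (auto simp: consecutive_def)
    moreover have "e \<subseteq> set (xs @ ys) \<and> e \<in> consecutive (xs @ ys)"
      if "e \<in> edges G" "e \<inter> set (xs @ ys) \<noteq> {}" for e
    proof (cases "e \<inter> set xs = {}")
      case True
      then have "e \<in> consecutive ys" using ys(3) that by auto
      then show ?thesis using sub consecutive_append[of xs ys] by auto
    next
      case False
      then show ?thesis using xs(4) that(1) consecutive_append[of xs ys] by auto
    qed
    ultimately show ?thesis
      using xs(1-3) ys(1,2) by (intro exI[of _ "xs @ ys"]) auto
  qed
qed

text \<open>The two forests may have different vertex sets, but both lists must cover all of
  \<open>V\<close>; the missing vertices are put at the end.\<close>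

lemma linear_forest_list:
  assumes G: "linear_forest G" and V: "finite V" "verts G \<subseteq> V"
  obtains xs where "distinct xs" "set xs = V" "edges G \<subseteq> consecutive xs"
proof -
  have simple: "simple_graph G" using G by (simp add: linear_forest_def forest_def)
  obtain xs where xs: "distinct xs" "set xs = verts G"
    "\<And>e. e \<in> edges G \<Longrightarrow> e \<inter> set xs \<noteq> {} \<Longrightarrow> e \<in> consecutive xs"
    using linear_forest_list_of_subset[OF G, of "verts G"] simple
    by (auto simp: simple_graph_def)
  obtain zs where zs: "set zs = V - verts G" "distinct zs"
    using V(1) finite_distinct_list by blast
  have "e \<in> consecutive xs" if "e \<in> edges G" for e
  proof (rule xs(3)[OF that])
    have "e \<subseteq> set xs" "card e = 2" using that simple xs(2) by (auto simp: simple_graph_def)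
    then have "e \<subseteq> set xs" "e \<noteq> {}" by auto
    then show "e \<inter> set xs \<noteq> {}" by blast
  qed
  then have "edges G \<subseteq> consecutive (xs @ zs)"
    using consecutive_append[of xs zs] by blast
  then show ?thesis using xs(1,2) zs V(2) that[of "xs @ zs"] by auto
qed

section \<open>Placing unit intervals on a line\<close>

lemma consecutive_nth_iff:
  assumes "distinct xs" and "i < j" and "j < length xs"
  shows "{xs ! i, xs ! j} \<in> consecutive xs \<longleftrightarrow> j = Suc i"
proof
  assume "{xs ! i, xs ! j} \<in> consecutive xs"
  then obtain k where "Suc k < length xs" "{xs ! i, xs ! j} = {xs ! k, xs ! Suc k}"
    by (auto simp: consecutive_def)
  with assms show "j = Suc i"
    by (auto simp: doubleton_eq_iff nth_eq_iff_index_eq)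
qed (use assms in \<open>auto simp: consecutive_def\<close>)

text \<open>\<open>E\<close> may be a proper subset of the consecutive pairs, since some pairs only
  join the end of one path to the start of the next, and since shared edges are removed from one
  forest.\<close>

lemma ex_unit_interval_placement:
  assumes xs: "distinct xs" and E: "E \<subseteq> consecutive xs"
  shows "\<exists>f :: 'a \<Rightarrow> real.
    \<forall>v\<in>set xs. \<forall>w\<in>set xs. v \<noteq> w \<longrightarrow> (\<bar>f v - f w\<bar> < 1 \<longleftrightarrow> {v, w} \<in> E)"
proof -
  \<comment> \<open>Past the end of the list the value is arbitrary, but still at least 1/2, so
    \<open>g\<close> is monotone on all naturals.\<close>
  define d :: "nat \<Rightarrow> real" where "d k = (if {xs ! k, xs ! Suc k} \<in> E then 1/2 else 1)" for k
  define g where "g n = sum d {..<n}" for n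
  have d: "1/2 \<le> d k" for k by (simp add: d_def)
  have g_Suc: "g (Suc n) = g n + d n" for n by (simp add: g_def)
  have "mono g"
    by (rule incseq_SucI) (use d in \<open>simp add: g_Suc add_increasing2 order_trans[OF _ d]\<close>)
  have g: "\<bar>g i - g j\<bar> < 1 \<longleftrightarrow> {xs ! i, xs ! j} \<in> E" if "i < j" "j < length xs" for i j
  proof (cases "j = Suc i")
    case True
    then show ?thesis by (simp add: g_Suc d_def)
  next
    case False
    \<comment> \<open>Here \<open>j\<close> is at least \<open>i + 2\<close>: two gaps of at least
      1/2 already give distance 1, at which unit intervals at most touch.\<close>
    then have "g (Suc (Suc i)) \<le> g j"
      using that by (simp add: monoD[OF \<open>mono g\<close>])
    then have "g i + 1 \<le> g j" using d[of i] d[of "Suc i"] by (simp add: g_Suc)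
    then show ?thesis using False consecutive_nth_iff[OF xs that] E by auto
  qed
  have "\<forall>v\<in>set xs. \<exists>i. i < length xs \<and> xs ! i = v" by (simp add: in_set_conv_nth)
  then obtain idx where idx: "\<And>v. v \<in> set xs \<Longrightarrow> idx v < length xs"
    "\<And>v. v \<in> set xs \<Longrightarrow> xs ! idx v = v"
    by (auto dest!: bchoice)
  have "\<bar>g (idx v) - g (idx w)\<bar> < 1 \<longleftrightarrow> {v, w} \<in> E"
    if "v \<in> set xs" "w \<in> set xs" "v \<noteq> w" for v w
  proof -
    have "idx v \<noteq> idx w" using idx(2) that by metis
    then consider "idx v < idx w" | "idx w < idx v" by linarith
    then show ?thesis
      using g[of "idx v" "idx w"] g[of "idx w" "idx v"] idx[OF that(1)] idx[OF that(2)]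
      by cases (simp_all add: abs_minus_commute insert_commute)
  qed
  then show ?thesis by (intro exI[of _ "g \<circ> idx"]) auto
qed

section \<open>Visibility bands as overlaps of coordinate intervals\<close>

lemma forest_triangle_free:
  assumes "forest G" and "u \<noteq> v" "u \<noteq> w" "v \<noteq> w"
  shows "\<not> ({u, v} \<in> edges G \<and> {v, w} \<in> edges G \<and> {w, u} \<in> edges G)"
proof
  assume E: "{u, v} \<in> edges G \<and> {v, w} \<in> edges G \<and> {w, u} \<in> edges G"
  then have "{u, v} \<subseteq> verts G" "{v, w} \<subseteq> verts G"
    using assms(1) unfolding forest_def simple_graph_def by blast+
  with E assms have "cycle_in G [u, v, w]"
    by (auto simp: cycle_in_def less_Suc_eq)
  with assms(1) show False by (auto simp: forest_def)
qed

lemma interior_unit_square: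
  "(s, c) \<in> interior (unit_square p) \<longleftrightarrow>
    fst p < s \<and> s < fst p + 1 \<and> snd p < c \<and> c < snd p + 1"
  by (cases p) (auto simp: unit_square_def interior_cbox box_def Basis_prod_def)

lemma horizontal_line_meets_interior:
  "horizontal_line c \<inter> interior (unit_square p) \<noteq> {} \<longleftrightarrow> snd p < c \<and> c < snd p + 1"
proof
  assume "snd p < c \<and> c < snd p + 1"
  then have "(fst p + 1/2, c) \<in> horizontal_line c \<inter> interior (unit_square p)"
    by (simp add: horizontal_line_def interior_unit_square)
  then show "horizontal_line c \<inter> interior (unit_square p) \<noteq> {}" by blast
qed (auto simp: horizontal_line_def interior_unit_square)

text \<open>The hypothesis forbids a third square whose vertical interval overlaps both others while
  these overlap each other, so the positions in the other coordinate do not matter.\<close>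

lemma horizontal_band_iff:
  assumes unblocked: "\<And>u. u \<in> V - {v, w} \<Longrightarrow>
    \<not> (\<bar>snd (p v) - snd (p w)\<bar> < 1 \<and> \<bar>snd (p w) - snd (p u)\<bar> < 1 \<and> \<bar>snd (p u) - snd (p v)\<bar> < 1)"
  shows "horizontal_band V p v w \<longleftrightarrow> \<bar>snd (p v) - snd (p w)\<bar> < 1"
proof
  assume "horizontal_band V p v w"
  then obtain a b where "a < b" and "\<forall>c\<in>{a<..<b}.
      snd (p v) < c \<and> c < snd (p v) + 1 \<and> snd (p w) < c \<and> c < snd (p w) + 1"
    unfolding horizontal_band_def horizontal_line_meets_interior by blast
  from this(2)[rule_format, of "(a + b) / 2"] \<open>a < b\<close>
  show "\<bar>snd (p v) - snd (p w)\<bar> < 1" by auto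
next
  assume vw: "\<bar>snd (p v) - snd (p w)\<bar> < 1"
  \<comment> \<open>The band is the full intersection of the two open vertical intervals.\<close>
  let ?a = "max (snd (p v)) (snd (p w))" and ?b = "min (snd (p v)) (snd (p w)) + 1"
  have "?a < ?b" using vw by auto
  moreover have "part_between c (unit_square (p v)) (unit_square (p w))
      \<inter> interior (unit_square (p u)) = {}" if c: "c \<in> {?a<..<?b}" and u: "u \<in> V - {v, w}" for c u
  proof -
    \<comment> \<open>Otherwise \<open>c\<close> would lie in three open unit intervals, making
      their lower ends pairwise less than 1 apart. Hence the whole line \<open>y = c\<close> misses
      the interior of the square of \<open>u\<close>.\<close>
    have "\<not> (snd (p u) < c \<and> c < snd (p u) + 1)"
      using unblocked[OF u] vw c by auto
    then show ?thesis
      by (auto simp: part_between_def part_from_to_def interior_unit_square)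
  qed
  ultimately show "horizontal_band V p v w"
    unfolding horizontal_band_def horizontal_line_meets_interior
    by (intro exI[of _ ?a] exI[of _ ?b]) auto
qed

text \<open>A blocking square would yield a triangle in \<open>E\<close>, hence in the forest
  \<open>F\<close>.\<close>

lemma horizontal_band_iff_forest_edge:
  assumes F: "forest F" and E: "E \<subseteq> edges F" and "v \<in> V" "w \<in> V" "v \<noteq> w"
    and p: "\<And>v w. v \<in> V \<Longrightarrow> w \<in> V \<Longrightarrow> v \<noteq> w \<Longrightarrow> \<bar>snd (p v) - snd (p w)\<bar> < 1 \<longleftrightarrow> {v, w} \<in> E"
  shows "horizontal_band V p v w \<longleftrightarrow> {v, w} \<in> E"
proof -
  have "horizontal_band V p v w \<longleftrightarrow> \<bar>snd (p v) - snd (p w)\<bar> < 1"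
  proof (rule horizontal_band_iff)
    fix u assume "u \<in> V - {v, w}"
    then show "\<not> (\<bar>snd (p v) - snd (p w)\<bar> < 1 \<and> \<bar>snd (p w) - snd (p u)\<bar> < 1 \<and>
        \<bar>snd (p u) - snd (p v)\<bar> < 1)"
      using forest_triangle_free[OF F, of v w u] assms(3-5) E by (auto simp: p)
  qed
  with assms(3-5) show ?thesis by (simp add: p)
qed

section \<open>Assembling the representation\<close>

lemma union_of_two_linear_forests_unit_rectangle_visibility:
  assumes fin: "finite (verts G)" and "union_of_linear_forests G 2"
  shows "unit_rectangle_visibility_graph G"
proof -
  let ?V = "verts G"
  obtain F where F: "\<And>i::nat. i < 2 \<Longrightarrow> linear_forest (F i)"
    and V: "?V = (\<Union>i<2. verts (F i))" and EG: "edges G = (\<Union>i<2. edges (F i))"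
    using assms(2) by (auto simp: union_of_linear_forests_def)
  have two: "{..<2::nat} = {0, 1}" by auto
  have forests: "forest (F 0)" "forest (F 1)"
    using F[of 0] F[of 1] by (auto simp: linear_forest_def)
  \<comment> \<open>A shared edge stays only with \<open>F 0\<close>: realised in both coordinates
    it would make the two interiors intersect.\<close>
  define E where "E = edges (F 1) - edges (F 0)"
  obtain xs where xs: "distinct xs" "set xs = ?V" "edges (F 0) \<subseteq> consecutive xs"
    by (rule linear_forest_list[OF F fin, of 0]) (auto simp: V two)
  obtain ys where ys: "distinct ys" "set ys = ?V" "edges (F 1) \<subseteq> consecutive ys"
    by (rule linear_forest_list[OF F fin, of 1]) (auto simp: V two)
  obtain y :: "'a \<Rightarrow> real" where y: "\<And>v w. v \<in> ?V \<Longrightarrow> w \<in> ?V \<Longrightarrow> v \<noteq> w \<Longrightarrow>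
      \<bar>y v - y w\<bar> < 1 \<longleftrightarrow> {v, w} \<in> edges (F 0)"
    using ex_unit_interval_placement[OF xs(1,3)] xs(2) by metis
  have "E \<subseteq> consecutive ys" using ys(3) by (auto simp: E_def)
  then obtain x :: "'a \<Rightarrow> real" where x: "\<And>v w. v \<in> ?V \<Longrightarrow> w \<in> ?V \<Longrightarrow> v \<noteq> w \<Longrightarrow>
      \<bar>x v - x w\<bar> < 1 \<longleftrightarrow> {v, w} \<in> E"
    using ex_unit_interval_placement[OF ys(1)] ys(2) by metis
  define p where "p v = (x v, y v)" for v
  have "interior (unit_square (p v)) \<inter> interior (unit_square (p w)) = {}"
    if "v \<in> ?V" "w \<in> ?V" "v \<noteq> w" for v w
  proof -
    have "\<not> (\<bar>x v - x w\<bar> < 1 \<and> \<bar>y v - y w\<bar> < 1)"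
      using x[OF that] y[OF that] by (simp add: E_def)
    then show ?thesis by (auto simp: interior_unit_square p_def)
  qed
  moreover have "{v, w} \<in> edges G \<longleftrightarrow> horizontal_band ?V p v w \<or> vertical_band ?V p v w"
    if "v \<in> ?V" "w \<in> ?V" "v \<noteq> w" for v w
  proof -
    have "horizontal_band ?V p v w \<longleftrightarrow> {v, w} \<in> edges (F 0)"
      by (rule horizontal_band_iff_forest_edge[OF forests(1) _ that]) (simp_all add: p_def y)
    \<comment> \<open>After the swap, the second coordinate of the corner is \<open>x v\<close>,
      which realises \<open>E\<close>.\<close>
    moreover have "vertical_band ?V p v w \<longleftrightarrow> {v, w} \<in> E"
      unfolding vertical_band_def
      by (rule horizontal_band_iff_forest_edge[OF forests(2) _ that]) (auto simp: p_def x E_def)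
    ultimately show ?thesis by (auto simp: EG E_def two)
  qed
  ultimately show ?thesis
    by (auto simp: unit_rectangle_visibility_graph_def unit_square_representation_def)
qed

theorem theorem4p6:
  fixes G :: "'a ugraph"
  assumes "simple_graph G"
    and "linear_arboricity G = 2"
  shows "unit_rectangle_visibility_graph G"
proof (rule union_of_two_linear_forests_unit_rectangle_visibility)
  show "finite (verts G)" using assms(1) by (simp add: simple_graph_def)
  show "union_of_linear_forests G 2"
    \<comment> \<open>Existence of some decomposition makes the \<open>LEAST\<close> an attained
      minimum, so the value 2 comes with two actual linear forests.\<close>
    using LeastI_ex[OF ex_union_of_linear_forests[OF assms(1)]] assms(2)
    by (simp add: linear_arboricity_def)
qed

end
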